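(* For all integers $k\ge 1$ and $d\ge 2$, the coefficients of $q^n$ in the formal power series $$(-1)^{k-1}\left(\frac{1}{(q;q)_\infty}\sum_{-k<n\le k}(-1)^nq^{n(3n-1)/2}-1\right)(q^d;q^d)_\infty$$ are zero for all $0\le n<k(3k+1)/2$, and are positive for all $n\ge k(3k+1)/2$.
   Context: Notation: $(a;q)_\infty=\prod_{j\ge 0}(1-aq^j)$; all series are formal power series in $q$. *)

theory Defs
  imports "HOL-Analysis.Analysis"
begin

(* The infinite product is taken in the X-adic topology carried by type fps; qpoch_inf_converges
   below shows that it exists in the cases of interest. Coefficients are rational rather than
   integer because int fps has no inverse. *)
definition qpoch_inf :: "rat fps \<Rightarrow> rat fps \<Rightarrow> rat fps" where
  "qpoch_inf a q = (\<Prod>j. 1 - a * q ^ j)"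

lemma qpoch_inf_converges:
  assumes "d \<ge> 1"
  shows "convergent_prod (\<lambda>j. 1 - fps_X ^ d * (fps_X ^ d) ^ j :: rat fps)"
proof -
  define f :: "nat \<Rightarrow> rat fps" where "f = (\<lambda>j. 1 - fps_X ^ d * (fps_X ^ d) ^ j)"
  define P where "P = (\<lambda>n. \<Prod>i\<le>n. f i)"
  have f_eq: "f j = 1 - fps_X ^ (d * Suc j)" for j
    by (simp add: f_def power_mult [symmetric] power_add [symmetric])
  have step: "fps_nth (P (Suc n)) m = fps_nth (P n) m" if "m \<le> n" for n m
  proof -
    have "n < d * Suc (Suc n)"
      using assms by (cases d) auto
    then have "m < d * Suc (Suc n)"
      using that by linarith
    moreover have "P (Suc n) = P n - P n * fps_X ^ (d * Suc (Suc n))"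
      by (simp add: P_def f_eq algebra_simps del: mult_Suc_right)
    ultimately show ?thesis
      by (simp add: fps_X_power_mult_right_nth del: mult_Suc_right)
  qed
  have stable: "fps_nth (P n) m = fps_nth (P m) m" if "m \<le> n" for n m
    using that by (induction n rule: dec_induct) (auto simp: step)
  define L where "L = Abs_fps (\<lambda>m. fps_nth (P m) m)"
  have "P \<longlonglongrightarrow> L"
    unfolding tendsto_fps_iff L_def
    by (auto intro!: eventually_sequentiallyI stable)
  moreover have "fps_nth L 0 = 1"
    using assms by (simp add: L_def P_def f_eq)
  then have "L \<noteq> 0" by auto
  ultimately have "raw_has_prod f 0 L"
    by (simp add: raw_has_prod_def P_def)
  then show ?thesis
    unfolding convergent_prod_def f_def by blast
qed

end

theory Submission
  imports Defs
begin

text \<open>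
  Write \<phi>(d) for the product of all 1 - X^(dj), and pent j = j(3j + 1)/2. By the pentagonal number
  theorem, F equals \<phi>(d) / \<phi>(1) times the alternating tail
  \<Sum>(j \<ge> k) (-1)^(j - k) (X^(pent j) - X^(pent j + 2j + 1)). The quotient \<phi>(d) / \<phi>(1) generates the
  partitions without multiples of d among the parts, so it is a series with nonnegative coefficients
  and constant term 1 times 1 / ((1 - X^a)(1 - X^b)(1 - X^c)), where {a, b, c} is {1, 3, 5} for d = 2,
  {1, 2, 5} for d = 3 and {1, 2, 3} for d \<ge> 4. For k \<ge> 2 these three factors alone already
  make the tail positive from the exponent pent k on: as a, b, c are pairwise coprime, the number of
  partitions of n into parts a, b, c is ((2n + s)^2 + bounded error) / (8abc) with s = a + b + c, the
  quadratic main terms telescope, and an elementary inequality remains. For k = 1 three factors do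
  not suffice, but there F = (1 - X) \<phi>(d) / \<phi>(1) - \<phi>(d), where the subtracted coefficients are
  at most 1 and the others count partitions without parts 1.
\<close>

section \<open>Alternating sums at pentagonal numbers\<close>

text \<open>The exponent n(3n - 1)/2 at n = -j; at n = j + 1 it is
  \<open>pent j + 2 * j + 1\<close>. So the range -k < n \<le> k splits into k blocks of two terms
  with opposite signs.\<close>

definition pent :: "nat \<Rightarrow> nat" where
  "pent j = j * (3 * j + 1) div 2"

lemma two_pent: "2 * pent j = j * (3 * j + 1)"
proof -
  have "even (j * (3 * j + 1))" by simp
  then show ?thesis unfolding pent_def by simp
qed

lemma two_int_pent: "2 * int (pent j) = int j * (3 * int j + 1)"
  using two_pent[of j] by (metis of_nat_mult of_nat_numeral of_nat_add of_nat_1)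

lemma pent_Suc: "pent (Suc j) = pent j + 3 * j + 2"
  using two_pent[of j] two_pent[of "Suc j"] by (simp add: algebra_simps)

lemma pent_mono: "i \<le> j \<Longrightarrow> pent i \<le> pent j"
  by (induction j rule: dec_induct) (auto simp: pent_Suc)

lemma le_pent: "j \<le> pent j"
  by (induction j) (auto simp: pent_Suc pent_def)

text \<open>If \<open>D j\<close> were equal to \<open>A (Suc j) + A j\<close>, the alternating sum
  would telescope to its two boundary terms; each actual term adds an error of at most
  \<open>E\<close>.\<close>

lemma alternating_sum_approx:
  fixes D A :: "nat \<Rightarrow> int" and E :: int
  assumes "k \<le> K"
    and "\<And>j. k \<le> j \<Longrightarrow> j < K \<Longrightarrow> \<bar>D j - (A (Suc j) + A j)\<bar> \<le> E"
  shows "\<bar>(\<Sum>j=k..<K. (-1) ^ (j + k) * D j) - (A k - (-1) ^ (K + k) * A K)\<bar> \<le> E * (int K - int k)"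
  using assms
proof (induction K rule: dec_induct)
  case base
  then show ?case by simp
next
  case (step K)
  have IH: "\<bar>(\<Sum>j=k..<K. (-1) ^ (j + k) * D j) - (A k - (-1) ^ (K + k) * A K)\<bar> \<le> E * (int K - int k)"
    using step by simp
  have D: "\<bar>D K - (A (Suc K) + A K)\<bar> \<le> E" using step by simp
  have "(-1::int) ^ (K + k) = 1 \<or> (-1::int) ^ (K + k) = -1"
    by (cases "even (K + k)") auto
  then show ?case using IH D step.hyps by (auto simp: algebra_simps)
qed

text \<open>
  Here \<open>p\<close> stands for the number of partitions into three parts: the triples \<open>(s, a, b)\<close> are the
  sum of the parts and the error bounds for the parts {1, 3, 5}, {1, 2, 5} and {1, 2, 3}.
\<close>

context
  fixes p :: "int \<Rightarrow> int" and c s a b :: int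
  assumes c: "c > 0"
    and p_neg: "\<And>x. x < 0 \<Longrightarrow> p x = 0"
    and p_pos: "\<And>x. x \<ge> 0 \<Longrightarrow> p x > 0"
    and p_lo: "\<And>x. x \<ge> 0 \<Longrightarrow> (2 * x + s)\<^sup>2 - a \<le> c * p x"
    and p_hi: "\<And>x. x \<ge> 0 \<Longrightarrow> c * p x \<le> (2 * x + s)\<^sup>2 + b"
    and sab: "(s, a, b) \<in> {(9, 49, 39), (8, 36, 16), (6, 16, 12)}"
begin

text \<open>
  With \<open>n = pent K + u\<close> and the error estimates inserted: the last block of the sum is incomplete
  (\<open>u \<le> 2 * K\<close>) in the first two claims and complete in the other two, and it enters with positive sign
  in the first and third.
\<close>

lemma block_inequalities:
  fixes k K u :: int
  defines "A \<equiv> 4 * k * (3 * K\<^sup>2 + K + 2 * u + s + 2 - 3 * k\<^sup>2)"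
  assumes k: "k \<ge> 2" and u: "u \<ge> 0"
  shows "K \<ge> k + 2 \<Longrightarrow> 0 < A - (a + b) * (K - k) - a + (2 * u - 2 * K + s)\<^sup>2 - 8 * K\<^sup>2 - 8 * K"
    and "K \<ge> k + 1 \<Longrightarrow> u \<le> 2 * K \<Longrightarrow>
      0 < A - (a + b) * (K - k) - b - (2 * u - 2 * K + s)\<^sup>2 + 8 * K\<^sup>2 + 8 * K"
    and "K \<ge> k + 2 \<Longrightarrow> u > 2 * K \<Longrightarrow>
      0 < A - (a + b) * (K - k + 1) + 4 * (K + 1) * (2 * u - 5 * K + s - 1)"
    and "K \<ge> k + 1 \<Longrightarrow> u \<le> 3 * K + 1 \<Longrightarrow>
      0 < A - (a + b) * (K - k + 1) - 4 * (K + 1) * (2 * u - 5 * K + s - 1)"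
proof -
  \<comment> \<open>Shifting \<open>k\<close> and \<open>K\<close> by their minima leaves
    polynomials in nonnegative variables; \<open>pos\<close> tells linear arithmetic the signs of
    the nonlinear monomials.\<close>
  define x where "x = k - 2"
  have x: "x \<ge> 0" "k = x + 2" using k by (auto simp: x_def)
  have pos: "0 \<le> x * y" "0 \<le> x * x" "0 \<le> y * y" "0 \<le> x * (y * y)" "0 \<le> x * (x * y)"
      "0 \<le> u * x" "0 \<le> u * y" if "y \<ge> 0" for y
    using x u that by simp_all
  show "0 < A - (a + b) * (K - k) - a + (2 * u - 2 * K + s)\<^sup>2 - 8 * K\<^sup>2 - 8 * K" if K: "K \<ge> k + 2"
  proof -
    define y where "y = K - k - 2"
    have y: "y \<ge> 0" "K = x + y + 4" using K x by (auto simp: y_def)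
    have "(2 * u - 2 * K + s)\<^sup>2 \<ge> 0" by simp
    moreover have "0 < A - (a + b) * (K - k) - a - 8 * K\<^sup>2 - 8 * K"
      using sab unfolding A_def x(2) y(2)
      by (auto simp: algebra_simps power2_eq_square)
        (use pos[OF y(1)] u x(1) y in linarith)+
    ultimately show ?thesis by linarith
  qed
  show "0 < A - (a + b) * (K - k) - b - (2 * u - 2 * K + s)\<^sup>2 + 8 * K\<^sup>2 + 8 * K"
    if K: "K \<ge> k + 1" and u2: "u \<le> 2 * K"
  proof -
    define y where "y = K - k - 1"
    have y: "y \<ge> 0" "K = x + y + 3" using K x by (auto simp: y_def)
    \<comment> \<open>The square is convex in \<open>u\<close>, so for 0 \<le> \<open>u\<close>
      \<le> \<open>2 * K\<close> it lies below its chord, which is linear in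
      \<open>u\<close>.\<close>
    have "0 \<le> 4 * u * (2 * K - u)" using u u2 by simp
    also have "\<dots> = 4 * s * u - 4 * s * K + s\<^sup>2 + 4 * K\<^sup>2 - (2 * u - 2 * K + s)\<^sup>2"
      by (simp add: algebra_simps power2_eq_square)
    finally have "(2 * u - 2 * K + s)\<^sup>2 \<le> 4 * s * u - 4 * s * K + s\<^sup>2 + 4 * K\<^sup>2" by simp
    moreover have "0 < A - (a + b) * (K - k) - b - (4 * s * u - 4 * s * K + s\<^sup>2 + 4 * K\<^sup>2) + 8 * K\<^sup>2 + 8 * K"
      using sab unfolding A_def x(2) y(2)
      by (auto simp: algebra_simps power2_eq_square)
        (use pos[OF y(1)] u u2 x(1) y in linarith)+
    ultimately show ?thesis by linarith
  qed
  show "0 < A - (a + b) * (K - k + 1) + 4 * (K + 1) * (2 * u - 5 * K + s - 1)"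
    if K: "K \<ge> k + 2" and u2: "u > 2 * K"
  proof -
    define y where "y = K - k - 2"
    have y: "y \<ge> 0" "K = x + y + 4" using K x by (auto simp: y_def)
    \<comment> \<open>In this claim \<open>u\<close> has the coefficient
      \<open>8 * (k + K + 1)\<close>, so the least value \<open>u = 2 * K + 1\<close> is the
      worst.\<close>
    have mono: "(k + K + 1) * u \<ge> (k + K + 1) * (2 * K + 1)"
      using u2 k K by (intro mult_left_mono) auto
    from mono[unfolded x(2) y(2)] show ?thesis
      using sab unfolding A_def x(2) y(2)
      by (auto simp: algebra_simps power2_eq_square)
        (use pos[OF y(1)] u u2 x(1) y in linarith)+
  qed
  show "0 < A - (a + b) * (K - k + 1) - 4 * (K + 1) * (2 * u - 5 * K + s - 1)"
    if K: "K \<ge> k + 1" and u2: "u \<le> 3 * K + 1"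
  proof -
    define y where "y = K - k - 1"
    have y: "y \<ge> 0" "K = x + y + 3" using K x by (auto simp: y_def)
    \<comment> \<open>Now \<open>u\<close> has the coefficient \<open>- 8 * (K - k + 1)\<close>, so
      the largest value \<open>u = 3 * K + 1\<close> is the worst.\<close>
    have mono: "(K - k + 1) * u \<le> (K - k + 1) * (3 * K + 1)"
      using u2 K by (intro mult_left_mono) auto
    from mono[unfolded x(2) y(2)] show ?thesis
      using sab unfolding A_def x(2) y(2)
      by (auto simp: algebra_simps power2_eq_square)
        (use pos[OF y(1)] u u2 x(1) y in linarith)+
  qed
qed

text \<open>Only in block \<open>K\<close> can the second argument of \<open>p\<close> be negative.
  The earlier blocks telescope up to an error of \<open>a + b\<close> each; the parity of
  \<open>K + k\<close> and the completeness of block \<open>K\<close> then give the four cases of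
  \<open>block_inequalities\<close>.\<close>

lemma alternating_pent_sum_pos:
  fixes k K n :: nat
  assumes k: "k \<ge> 2" "k \<le> K" and n: "pent K \<le> n" "n < pent (Suc K)"
  shows "0 < (\<Sum>j=k..K. (-1) ^ (j + k) *
    (p (int n - int (pent j)) - p (int n - int (pent j) - 2 * int j - 1)))"
proof -
  define D where "D j = p (int n - int (pent j)) - p (int n - int (pent j) - 2 * int j - 1)" for j
  \<comment> \<open>\<open>A (Suc j) + A j\<close> is the main term of \<open>c * D j\<close>, see \<open>A_Suc\<close>.\<close>
  define A where "A j = 4 * int j * (2 * int n + s + 2 - 3 * (int j)\<^sup>2)" for j
  define u where "u = int n - int (pent K)"
  have u0: "u \<ge> 0" and u3: "u \<le> 3 * int K + 1"
    using n by (auto simp: u_def pent_Suc)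
  have A_Suc: "A (Suc j) + A j =
      (2 * (int n - int (pent j)) + s)\<^sup>2 - (2 * (int n - int (pent j) - 2 * int j - 1) + s)\<^sup>2" for j
  proof -
    have "2 * (2 * int j + 1) * (4 * (int n - int (pent j)) + 2 * s - 2 * (2 * int j + 1)) =
      2 * (2 * int j + 1) * (4 * int n - 2 * (int j * (3 * int j + 1)) + 2 * s - 2 * (2 * int j + 1))"
      unfolding two_int_pent[of j, symmetric] by simp
    then show ?thesis unfolding A_def
      by (simp add: algebra_simps power2_eq_square)
  qed
  have approx: "\<bar>c * D j - (A (Suc j) + A j)\<bar> \<le> a + b"
    if "0 \<le> int n - int (pent j) - 2 * int j - 1" for j
    using that p_lo[of "int n - int (pent j)"] p_hi[of "int n - int (pent j)"]
     p_lo[of "int n - int (pent j) - 2 * int j - 1"] p_hi[of "int n - int (pent j) - 2 * int j - 1"]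
    unfolding D_def A_Suc by (simp add: algebra_simps)
  have early: "0 \<le> int n - int (pent j) - 2 * int j - 1" if "j < K" for j
    using pent_mono[of "Suc j" K] that n by (simp add: pent_Suc)
  define S where "S = (\<Sum>j=k..<K. (-1) ^ (j + k) * D j)"
  have "\<bar>(\<Sum>j=k..<K. (-1) ^ (j + k) * (c * D j)) - (A k - (-1) ^ (K + k) * A K)\<bar>
      \<le> (a + b) * (int K - int k)"
    using k approx early by (intro alternating_sum_approx) auto
  then have S: "\<bar>c * S - (A k - (-1) ^ (K + k) * A K)\<bar> \<le> (a + b) * (int K - int k)"
    by (simp add: S_def sum_distrib_left mult_ac)
  have Ak: "A k = 4 * int k * (3 * (int K)\<^sup>2 + int K + 2 * u + s + 2 - 3 * (int k)\<^sup>2)"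
    and AK: "A K = 4 * int K * (int K + 2 * u + s + 2)"
    and ASK: "A (Suc K) = 4 * (int K + 1) * (2 * u - 5 * int K + s - 1)"
    using two_int_pent[of K] unfolding A_def u_def
    by (simp_all add: algebra_simps power2_eq_square)
  have total: "(\<Sum>j=k..K. (-1) ^ (j + k) * D j) = S + (-1) ^ (K + k) * D K"
    using k by (simp add: S_def sum.last_plus atLeastLessThanSuc_atLeastAtMost[symmetric])
  have pos: "0 < c * (S + (-1) ^ (K + k) * D K)"
  proof (cases "K = k")
    case True
    then have [simp]: "S = 0" by (simp add: S_def)
    have "0 < D K"
    proof (cases "u \<le> 2 * int K")
      case True
      then show ?thesis using u0 p_neg p_pos by (simp add: D_def u_def)
    next
      case False
      have "\<bar>c * D K - (A (Suc K) + A K)\<bar> \<le> a + b"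
        using False by (intro approx) (auto simp: u_def)
      moreover have "A (Suc K) + A K > a + b"
      proof -
        have "A (Suc K) + A K = 4 * (2 * int K + 1) * (2 * u + s - 2 * int K - 1)"
          unfolding ASK AK by (simp add: algebra_simps)
        \<comment> \<open>Here \<open>K = k\<close> \<ge> 2 gives \<open>2 * K + 1\<close> \<ge> 5,
          and \<open>u\<close> \<ge> \<open>2 * K + 1\<close> makes the last factor at least
          \<open>s + 2 * K + 1\<close>.\<close>
        also have "\<dots> \<ge> (4 * 5) * (s + 5)"
          using k False sab \<open>K = k\<close> by (intro mult_mono) auto
        finally show ?thesis using sab by auto
      qed
      ultimately have "c * D K > 0" by linarith
      then show ?thesis using c by (simp add: zero_less_mult_iff)
    qed
    then show ?thesis using True c by (simp add: zero_less_mult_iff mult_2[symmetric])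
  next
    case False
    have k2: "int k \<ge> 2" using k by simp
    note ineqs = block_inequalities[OF k2 u0, of "int K", folded Ak]
    show ?thesis
    proof (cases "u \<le> 2 * int K")
      case True
      \<comment> \<open>The second argument is \<open>u - 2 * K - 1\<close> < 0, so the block
        consists of its first value only.\<close>
      then have "D K = p u" using p_neg by (simp add: D_def u_def)
      moreover have "(2 * u + s)\<^sup>2 - A K = (2 * u - 2 * int K + s)\<^sup>2 - 8 * (int K)\<^sup>2 - 8 * int K"
        unfolding AK by (simp add: algebra_simps power2_eq_square)
      ultimately have D: "(2 * u - 2 * int K + s)\<^sup>2 - 8 * (int K)\<^sup>2 - 8 * int K - a \<le> c * D K - A K"
        "c * D K - A K \<le> (2 * u - 2 * int K + s)\<^sup>2 - 8 * (int K)\<^sup>2 - 8 * int K + b"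
        using p_lo[OF u0] p_hi[OF u0] by auto
      show ?thesis
      proof (cases "even (K + k)")
        case True
        then have "int K \<ge> int k + 2" using k False by presburger
        from ineqs(1)[OF this] show ?thesis using S D True by (simp add: algebra_simps)
      next
        case odd: False
        have "int K \<ge> int k + 1" using k False by simp
        from ineqs(2)[OF this] show ?thesis using S D odd True by (simp add: algebra_simps)
      qed
    next
      case u2: False
      have D: "\<bar>c * D K - (A (Suc K) + A K)\<bar> \<le> a + b"
        using u2 by (intro approx) (auto simp: u_def)
      show ?thesis
      proof (cases "even (K + k)")
        case True
        then have "int K \<ge> int k + 2" using k False by presburger
        from ineqs(3)[OF this] show ?thesis using S D True u2 unfolding ASK[symmetric]
          by (simp add: algebra_simps)
      next
        case odd: False
        have "int K \<ge> int k + 1" using k False by simp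
        from ineqs(4)[OF this] show ?thesis using S D odd u3 unfolding ASK[symmetric]
          by (simp add: algebra_simps)
      qed
    qed
  qed
  then show ?thesis
    using c total unfolding D_def by (simp add: zero_less_mult_iff)
qed

end

section \<open>Counting partitions with few part sizes\<close>

text \<open>For distinct positive entries, this counts the partitions of \<open>n\<close> into parts
  from the list. The guard \<open>0 < a\<close> makes the recursion terminate.\<close>

fun part_count :: "nat list \<Rightarrow> nat \<Rightarrow> nat" where
  "part_count [] n = (if n = 0 then 1 else 0)"
| "part_count (a # as) n =
    part_count as n + (if 0 < a \<and> a \<le> n then part_count (a # as) (n - a) else 0)"

declare part_count.simps [simp del]

text \<open>Multiplying by 1 - X^a cancels the recursive call and leaves the series for the rest of
  the list.\<close>

lemma part_count_fps:
  assumes "0 \<notin> set as"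
  shows "Abs_fps (\<lambda>n. of_nat (part_count as n)) * (\<Prod>a\<leftarrow>as. 1 - fps_X ^ a) = (1 :: rat fps)"
  using assms
proof (induction as)
  case Nil
  then show ?case by (simp add: fps_eq_iff part_count.simps)
next
  case (Cons a as)
  have "Abs_fps (\<lambda>n. of_nat (part_count (a # as) n)) * (1 - fps_X ^ a) =
      (Abs_fps (\<lambda>n. of_nat (part_count as n)) :: rat fps)"
    using Cons.prems by (auto simp: fps_eq_iff part_count.simps(2)[of a as] right_diff_distrib fps_X_power_mult_right_nth)
  then show ?case using Cons by (simp add: mult.assoc[symmetric])
qed

lemma part_count_1: "part_count [1] n = 1"
proof (induction n)
  case 0
  show ?case by (simp add: part_count.simps)
next
  case (Suc n)
  then show ?case by (subst part_count.simps(2)) (simp add: part_count.simps(1))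
qed

lemma part_count_b_1: "b > 0 \<Longrightarrow> part_count [b, 1] n = n div b + 1"
proof (induction n rule: less_induct)
  case (less n)
  have "part_count [b, 1] n = 1 + (if b \<le> n then part_count [b, 1] (n - b) else 0)"
    by (subst part_count.simps(2)) (simp only: part_count_1 less.prems simp_thms)
  then show ?case
    using less.IH[of "n - b"] less.prems by (simp add: le_div_geq split: if_splits)
qed

lemma part_count_c_b_1:
  "b > 0 \<Longrightarrow> c > 0 \<Longrightarrow>
    part_count [c, b, 1] n = n div b + 1 + (if c \<le> n then part_count [c, b, 1] (n - c) else 0)"
  by (subst part_count.simps(2)) (simp only: part_count_b_1 simp_thms)

text \<open>The right-hand side of \<open>step\<close> is the difference of the squares at n and n -
  l. Hence the error has exact period \<open>l\<close>, and one period decides.\<close>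

lemma approx_by_period:
  fixes f :: "nat \<Rightarrow> nat" and c s a b :: int
  assumes step: "\<And>n. n \<ge> l \<Longrightarrow> c * (int (f n) - int (f (n - l))) = 4 * int l * (2 * int n - int l + s)"
    and base: "\<forall>n\<in>{..<l}. c * int (f n) - (2 * int n + s)\<^sup>2 \<in> {- a..b}"
    and "l > 0"
  shows "c * int (f n) - (2 * int n + s)\<^sup>2 \<in> {- a..b}"
proof (induction n rule: less_induct)
  case (less n)
  show ?case
  proof (cases "n < l")
    case True
    then show ?thesis using base by blast
  next
    case False
    then have "n - l < n" using \<open>l > 0\<close> by simp
    then have "c * int (f (n - l)) - (2 * int (n - l) + s)\<^sup>2 \<in> {- a..b}" by (rule less)
    moreover have "c * int (f (n - l)) - (2 * int (n - l) + s)\<^sup>2 = c * int (f n) - (2 * int n + s)\<^sup>2"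
      using step[of n] False by (simp add: of_nat_diff algebra_simps power2_eq_square)
    ultimately show ?thesis by simp
  qed
qed

text \<open>The numbers n, n - 5, n - 10 cover all residues modulo 3, so their remainders always add
  up to 3. The next two lemmas use opposite parity in the same way.\<close>

lemma floor_sum_135: "n \<ge> 15 \<Longrightarrow> n div 3 + 1 + ((n - 5) div 3 + 1 + ((n - 10) div 3 + 1)) = n - 3" for n :: nat
proof -
  assume "n \<ge> 15"
  then obtain m where "n = m + 15" using le_Suc_ex by (metis add.commute)
  moreover obtain q r where "m = 3 * q + r" "r < 3"
    using div_mult_mod_eq[of m 3] by (metis mult.commute mod_less_divisor zero_less_numeral)
  moreover from this have "r = 0 \<or> r = 1 \<or> r = 2" by auto
  ultimately show ?thesis by auto
qed

lemma floor_sum_125: "n \<ge> 10 \<Longrightarrow> n div 2 + 1 + ((n - 5) div 2 + 1) = n - 1" for n :: nat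
  by presburger

lemma floor_sum_123: "n \<ge> 6 \<Longrightarrow> n div 2 + 1 + ((n - 3) div 2 + 1) = n" for n :: nat
  by presburger

text \<open>Stripping the part 5 three times shifts by 15 = 3 * 5, where the floors add up to a
  linear term. The factor is 120 = 8 * 1 * 3 * 5; the bounds -49 and 39 are attained at n = 2 and n
  = 0.\<close>

lemma part_count_135_approx:
  "120 * int (part_count [5, 3, 1] n) - (2 * int n + 9)\<^sup>2 \<in> {-49..39}"
proof (rule approx_by_period)
  fix n :: nat assume n: "n \<ge> 15"
  have *: "part_count [5, 3, 1] m = m div 3 + 1 + (if 5 \<le> m then part_count [5, 3, 1] (m - 5) else 0)" for m
    by (rule part_count_c_b_1) simp_all
  have "part_count [5, 3, 1] n = n div 3 + 1 + ((n - 5) div 3 + 1 + ((n - 10) div 3 + 1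
      + part_count [5, 3, 1] (n - 15)))"
    using n *[of n] *[of "n - 5"] *[of "n - 10"] by (simp add: le_diff_conv2 del: One_nat_def)
  moreover have "n div 3 + 1 + ((n - 5) div 3 + 1 + ((n - 10) div 3 + 1)) = n - 3"
    using n by (rule floor_sum_135)
  ultimately have "int (part_count [5, 3, 1] n) = int (part_count [5, 3, 1] (n - 15)) + int n - 3"
    using n by linarith
  then show "120 * (int (part_count [5, 3, 1] n) - int (part_count [5, 3, 1] (n - 15)))
      = 4 * int 15 * (2 * int n - int 15 + 9)"
    by simp
qed (simp_all add: lessThan_nat_numeral part_count.simps)

text \<open>
  The parts {1, 2, 4} would not do here: 2 and 4 are not coprime, so the error would grow linearly.
\<close>

lemma part_count_125_approx:
  "80 * int (part_count [5, 2, 1] n) - (2 * int n + 8)\<^sup>2 \<in> {-36..16}"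
proof (rule approx_by_period)
  fix n :: nat assume n: "n \<ge> 10"
  have *: "part_count [5, 2, 1] m = m div 2 + 1 + (if 5 \<le> m then part_count [5, 2, 1] (m - 5) else 0)" for m
    by (rule part_count_c_b_1) simp_all
  have "part_count [5, 2, 1] n = n div 2 + 1 + ((n - 5) div 2 + 1 + part_count [5, 2, 1] (n - 10))"
    using n *[of n] *[of "n - 5"] by (simp add: le_diff_conv2 del: One_nat_def)
  moreover have "n div 2 + 1 + ((n - 5) div 2 + 1) = n - 1"
    using n by (rule floor_sum_125)
  ultimately have "int (part_count [5, 2, 1] n) = int (part_count [5, 2, 1] (n - 10)) + int n - 1"
    using n by linarith
  then show "80 * (int (part_count [5, 2, 1] n) - int (part_count [5, 2, 1] (n - 10)))
      = 4 * int 10 * (2 * int n - int 10 + 8)"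
    by simp
qed (simp_all add: lessThan_nat_numeral part_count.simps)

lemma part_count_123_approx:
  "48 * int (part_count [3, 2, 1] n) - (2 * int n + 6)\<^sup>2 \<in> {-16..12}"
proof (rule approx_by_period)
  fix n :: nat assume n: "n \<ge> 6"
  have *: "part_count [3, 2, 1] m = m div 2 + 1 + (if 3 \<le> m then part_count [3, 2, 1] (m - 3) else 0)" for m
    by (rule part_count_c_b_1) simp_all
  have "part_count [3, 2, 1] n = n div 2 + 1 + ((n - 3) div 2 + 1 + part_count [3, 2, 1] (n - 6))"
    using n *[of n] *[of "n - 3"] by (simp add: le_diff_conv2 del: One_nat_def)
  moreover have "n div 2 + 1 + ((n - 3) div 2 + 1) = n"
    using n by (rule floor_sum_123)
  ultimately have "int (part_count [3, 2, 1] n) = int (part_count [3, 2, 1] (n - 6)) + int n"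
    using n by linarith
  then show "48 * (int (part_count [3, 2, 1] n) - int (part_count [3, 2, 1] (n - 6)))
      = 4 * int 6 * (2 * int n - int 6 + 6)"
    by simp
qed (simp_all add: lessThan_nat_numeral part_count.simps)

lemma part_count_c_b_1_pos: "b > 0 \<Longrightarrow> c > 0 \<Longrightarrow> part_count [c, b, 1] n > 0"
  by (subst part_count_c_b_1) (simp_all only: add_gr_0 zero_less_one simp_thms)

section \<open>Lower bounds on partition counts for the case k = 1\<close>

lemma part_count_mono_add: "a > 0 \<Longrightarrow> part_count (a # as) n \<le> part_count (a # as) (n + a)"
  by (subst (2) part_count.simps(2)) simp

text \<open>Adding one more copy of the part \<open>a\<close> never lowers the count, so a lower
  bound on \<open>a\<close> consecutive values persists.\<close>

lemma le_part_count_by_period: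
  assumes base: "\<forall>n\<in>{N..<N + a}. m \<le> part_count (a # as) n" and "a > 0" "n \<ge> N"
  shows "m \<le> part_count (a # as) n"
  using \<open>n \<ge> N\<close>
proof (induction n rule: less_induct)
  case (less n)
  show ?case
  proof (cases "n < N + a")
    case True
    then show ?thesis using base less.prems by simp
  next
    case False
    then have "m \<le> part_count (a # as) (n - a)" using less \<open>a > 0\<close> by simp
    also have "\<dots> \<le> part_count (a # as) n" using part_count_mono_add[of a as "n - a"] False \<open>a > 0\<close> by simp
    finally show ?thesis .
  qed
qed

text \<open>Meant for d = 2: after its constant term \<phi>(2) has no positive coefficient before
  X^10 and none at odd exponents. So two partitions are provided where it might be 1 and one
  elsewhere, except at n = 2 and n = 4, where it is -1. The next two lemmas serve d = 3 and d \<ge>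
  4.\<close>

lemma part_count_357:
  "n \<in> {3, 5, 6, 7, 8, 9, 11} \<Longrightarrow> part_count [3, 5, 7] n \<ge> 1"
  "n = 10 \<or> n \<ge> 12 \<Longrightarrow> part_count [3, 5, 7] n \<ge> 2"
proof -
  show "n \<in> {3, 5, 6, 7, 8, 9, 11} \<Longrightarrow> part_count [3, 5, 7] n \<ge> 1"
    by (elim insertE emptyE) (simp_all add: part_count.simps)
  have "\<forall>n\<in>{12..<12 + 3}. 2 \<le> part_count [3, 5, 7] n"
    by (simp add: atLeastLessThan_nat_numeral part_count.simps)
  from le_part_count_by_period[OF this] have "part_count [3, 5, 7] n \<ge> 2" if "n \<ge> 12"
    using that by simp
  moreover have "part_count [3, 5, 7] 10 = 2" by (simp add: part_count.simps)
  ultimately show "n = 10 \<or> n \<ge> 12 \<Longrightarrow> part_count [3, 5, 7] n \<ge> 2" by auto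
qed

lemma part_count_25:
  "n \<ge> 4 \<Longrightarrow> part_count [2, 5] n \<ge> 1" "n = 2 \<Longrightarrow> part_count [2, 5] n \<ge> 1"
  "n \<ge> 14 \<Longrightarrow> part_count [2, 5] n \<ge> 2"
proof -
  have "\<forall>n\<in>{4..<4 + 2}. 1 \<le> part_count [2, 5] n" "\<forall>n\<in>{14..<14 + 2}. 2 \<le> part_count [2, 5] n"
    by (simp_all add: atLeastLessThan_nat_numeral part_count.simps)
  from this[THEN le_part_count_by_period]
  show "n \<ge> 4 \<Longrightarrow> part_count [2, 5] n \<ge> 1" "n \<ge> 14 \<Longrightarrow> part_count [2, 5] n \<ge> 2"
    by auto
  show "n = 2 \<Longrightarrow> part_count [2, 5] n \<ge> 1" by (simp add: part_count.simps)
qed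

lemma part_count_23:
  "n \<ge> 2 \<Longrightarrow> part_count [2, 3] n \<ge> 1" "n \<ge> 8 \<Longrightarrow> part_count [2, 3] n \<ge> 2"
proof -
  have "\<forall>n\<in>{2..<2 + 2}. 1 \<le> part_count [2, 3] n" "\<forall>n\<in>{8..<8 + 2}. 2 \<le> part_count [2, 3] n"
    by (simp_all add: atLeastLessThan_nat_numeral part_count.simps)
  from this[THEN le_part_count_by_period]
  show "n \<ge> 2 \<Longrightarrow> part_count [2, 3] n \<ge> 1" "n \<ge> 8 \<Longrightarrow> part_count [2, 3] n \<ge> 2" by auto
qed

section \<open>Quotients of infinite products\<close>

text \<open>Congruence modulo X^(n+1), which allows finite products to replace infinite
  ones.\<close>

definition fps_agree :: "nat \<Rightarrow> rat fps \<Rightarrow> rat fps \<Rightarrow> bool" where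
  "fps_agree n f g \<longleftrightarrow> (\<forall>m\<le>n. fps_nth f m = fps_nth g m)"

lemma fps_agree_refl: "fps_agree n f f"
  by (simp add: fps_agree_def)

lemma fps_agree_sym: "fps_agree n f g \<Longrightarrow> fps_agree n g f"
  by (simp add: fps_agree_def)

lemma fps_agree_trans [trans]: "fps_agree n f g \<Longrightarrow> fps_agree n g h \<Longrightarrow> fps_agree n f h"
  by (simp add: fps_agree_def)

lemma fps_agree_diff: "fps_agree n f f' \<Longrightarrow> fps_agree n g g' \<Longrightarrow> fps_agree n (f - g) (f' - g')"
  by (simp add: fps_agree_def)

lemma fps_agree_mult: "fps_agree n f f' \<Longrightarrow> fps_agree n g g' \<Longrightarrow> fps_agree n (f * g) (f' * g')"
  unfolding fps_agree_def fps_mult_nth by (intro allI impI sum.cong) auto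

text \<open>Modulo X^(n+1) the factor \<open>v\<close> may be replaced by \<open>u\<close>, a unit
  because of its constant term.\<close>

lemma fps_agree_mult_cancel:
  assumes "fps_agree n (f * u) (g * v)" "fps_agree n u v" "fps_nth u 0 = 1"
  shows "fps_agree n f g"
proof -
  have "u * inverse u = 1" using assms(3) by (intro inverse_mult_eq_1') simp
  have "fps_agree n ((f - g) * u * inverse u) (0 * inverse u)"
  proof (rule fps_agree_mult[OF _ fps_agree_refl])
    have "fps_agree n (g * v) (g * u)" using assms(2) by (intro fps_agree_mult fps_agree_refl) (rule fps_agree_sym)
    with assms(1) have "fps_agree n (f * u) (g * u)" by (rule fps_agree_trans)
    then show "fps_agree n ((f - g) * u) 0" by (simp add: fps_agree_def left_diff_distrib)
  qed
  then have "fps_agree n (f - g) 0" using \<open>u * inverse u = 1\<close> by (simp add: mult.assoc)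
  then show ?thesis by (simp add: fps_agree_def)
qed

text \<open>Factors with index above \<open>N\<close> differ from 1 only beyond exponent
  \<open>n\<close>, so these coefficients are already stable; the series \<open>L\<close> of stable
  coefficients is the limit.\<close>

lemma fps_agree_qpoch_inf:
  assumes d: "d \<ge> 1" and "N \<ge> n"
  shows "fps_agree n (qpoch_inf (fps_X ^ d) (fps_X ^ d)) (\<Prod>i=1..N. 1 - fps_X ^ (d * i))"
proof -
  define P :: "nat \<Rightarrow> rat fps" where "P N = (\<Prod>i=1..N. 1 - fps_X ^ (d * i))" for N
  have step: "fps_nth (P (Suc N)) m = fps_nth (P N) m" if "m \<le> N" for m N
  proof -
    have "m < d * Suc N" using that d by (cases d) auto
    moreover have "P (Suc N) = P N - P N * fps_X ^ (d * Suc N)"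
      by (simp add: P_def algebra_simps del: mult_Suc_right)
    ultimately show ?thesis by (simp add: fps_X_power_mult_right_nth del: mult_Suc_right)
  qed
  have stable: "fps_nth (P N) m = fps_nth (P m) m" if "m \<le> N" for m N
    using that by (induction N rule: dec_induct) (auto simp: step)
  define L where "L = Abs_fps (\<lambda>m. fps_nth (P m) m)"
  have "(\<lambda>N. \<Prod>i\<le>N. 1 - fps_X ^ d * (fps_X ^ d) ^ i :: rat fps) = (\<lambda>N. P (Suc N))"
  proof
    fix N
    have "P (Suc N) = (\<Prod>i\<in>{0..N}. 1 - fps_X ^ (d * Suc i))"
      unfolding P_def One_nat_def by (rule prod.shift_bounds_cl_Suc_ivl)
    then show "(\<Prod>i\<le>N. 1 - fps_X ^ d * (fps_X ^ d) ^ i :: rat fps) = P (Suc N)"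
      by (simp add: power_mult power_add atMost_atLeast0)
  qed
  moreover have "(\<lambda>N. P (Suc N)) \<longlonglongrightarrow> L"
    unfolding tendsto_fps_iff
  proof
    fix m
    show "\<forall>\<^sub>F N in sequentially. fps_nth (P (Suc N)) m = fps_nth L m"
      by (rule eventually_sequentiallyI[of m]) (auto simp: L_def intro!: stable)
  qed
  moreover have "fps_nth L 0 = 1" by (simp add: L_def P_def)
  then have "L \<noteq> 0" by auto
  ultimately have "(\<lambda>i. 1 - fps_X ^ d * (fps_X ^ d) ^ i) has_prod L"
    by (simp add: has_prod_def raw_has_prod_def)
  then have "qpoch_inf (fps_X ^ d) (fps_X ^ d) = L"
    unfolding qpoch_inf_def by (rule has_prod_unique[symmetric])
  then show ?thesis
    unfolding fps_agree_def P_def[symmetric] using \<open>N \<ge> n\<close> by (auto simp: L_def intro!: stable[symmetric])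
qed

lemma qpoch_inf_nth_0: "d \<ge> 1 \<Longrightarrow> fps_nth (qpoch_inf (fps_X ^ d) (fps_X ^ d)) 0 = 1"
  using fps_agree_qpoch_inf[of d 0 0] by (simp add: fps_agree_def)

lemma fps_prod_nonneg:
  fixes f :: "'i \<Rightarrow> rat fps"
  assumes "\<And>i m. i \<in> I \<Longrightarrow> fps_nth (f i) m \<ge> 0"
  shows "fps_nth (\<Prod>i\<in>I. f i) m \<ge> 0"
  using assms
proof (induction I arbitrary: m rule: infinite_finite_induct)
  case (insert i I)
  then show ?case by (auto simp: fps_mult_nth intro!: sum_nonneg mult_nonneg_nonneg)
qed auto

lemma inverse_one_minus_X_power_nonneg:
  assumes "i > 0"
  shows "fps_nth (inverse (1 - fps_X ^ i) :: rat fps) m \<ge> 0"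
proof -
  define g :: "rat fps" where "g = inverse (1 - fps_X ^ i)"
  have "g * (1 - fps_X ^ i) = 1" unfolding g_def using assms by (intro inverse_mult_eq_1) simp
  then have *: "g = 1 + g * fps_X ^ i" by (simp add: algebra_simps)
  have rec: "fps_nth g m = (if m = 0 then 1 else 0) + (if m < i then 0 else fps_nth g (m - i))" for m
    using arg_cong[OF *, of "\<lambda>f. fps_nth f m"] by (simp add: fps_X_power_mult_right_nth)
  have "fps_nth g m \<ge> 0"
  proof (induction m rule: less_induct)
    case (less m)
    then show ?case using assms rec[of m] by simp
  qed
  then show ?thesis by (simp add: g_def)
qed

text \<open>The quotient \<phi>(1) / \<phi>(d) is the product of 1 - X^i over all i not divisible by
  \<open>d\<close>. \<open>Y\<close> accounts for the factors in \<open>L\<close>, and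
  \<open>B\<close> inverts the remaining ones, truncated.\<close>

lemma regular_quotient_factor:
  fixes F T Y :: "rat fps"
  assumes d: "d \<ge> 1"
    and F: "F * qpoch_inf fps_X fps_X = T * qpoch_inf (fps_X ^ d) (fps_X ^ d)"
    and L: "finite L" "\<And>i. i \<in> L \<Longrightarrow> \<not> d dvd i"
    and Y: "fps_agree n (Y * (\<Prod>i\<in>L. 1 - fps_X ^ i)) T"
  obtains B where "fps_nth B 0 = 1" "\<And>m. fps_nth B m \<ge> 0" "fps_agree n F (Y * B)"
proof -
  obtain M where M: "\<forall>i\<in>L. i \<le> M" using L(1) finite_nat_set_iff_bounded_le by blast
  \<comment> \<open>\<open>N\<close> must reach \<open>n\<close> for the truncation and
    \<open>M\<close> to cover \<open>L\<close>. Cutting \<phi>(1) at \<open>d * N\<close> makes the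
    multiples of \<open>d\<close> in range exactly d * 1, ..., d * N.\<close>
  define N where "N = max n M"
  define I where "I = {i\<in>{1..d * N}. \<not> d dvd i}"
  have "N \<le> d * N" using d by simp
  have LI: "L \<subseteq> I"
  proof
    fix i assume "i \<in> L"
    then have "i \<le> M" "\<not> d dvd i" using M L(2) by auto
    then show "i \<in> I" using \<open>N \<le> d * N\<close> by (cases "i = 0") (auto simp: I_def N_def)
  qed
  have finI: "finite I" by (simp add: I_def)
  define B :: "rat fps" where "B = (\<Prod>i\<in>I - L. inverse (1 - fps_X ^ i))"
  have B0: "fps_nth B 0 = 1"
  proof -
    have "fps_nth (\<Prod>i\<in>J. inverse (1 - fps_X ^ i) :: rat fps) 0 = 1" if "J \<subseteq> I" for J
      using finite_subset[OF that finI] that by (induction J) (auto simp: I_def)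
    then show ?thesis unfolding B_def by blast
  qed
  have B_nonneg: "fps_nth B m \<ge> 0" for m
    unfolding B_def by (intro fps_prod_nonneg inverse_one_minus_X_power_nonneg) (auto simp: I_def)
  have B_mult: "B * (\<Prod>i\<in>I - L. 1 - fps_X ^ i) = 1"
    unfolding B_def prod.distrib[symmetric]
    by (intro prod.neutral ballI inverse_mult_eq_1) (auto simp: I_def)
  have split: "(\<Prod>i=1..d * N. 1 - fps_X ^ i :: rat fps) =
      (\<Prod>i=1..N. 1 - fps_X ^ (d * i)) * ((\<Prod>i\<in>L. 1 - fps_X ^ i) * (\<Prod>i\<in>I - L. 1 - fps_X ^ i))"
  proof -
    have "{1..d * N} = (\<lambda>i. d * i) ` {1..N} \<union> I"
    proof (intro equalityI subsetI)
      fix i assume "i \<in> {1..d * N}"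
      then show "i \<in> (\<lambda>i. d * i) ` {1..N} \<union> I"
        using d by (cases "d dvd i") (auto simp: I_def elim!: dvdE)
    next
      fix i assume "i \<in> (\<lambda>i. d * i) ` {1..N} \<union> I"
      then show "i \<in> {1..d * N}" using d by (auto simp: I_def)
    qed
    moreover have "(\<lambda>i. d * i) ` {1..N} \<inter> I = {}" by (auto simp: I_def)
    moreover have "inj_on (\<lambda>i. d * i) {1..N}" using d by (auto simp: inj_on_def)
    ultimately have "(\<Prod>i=1..d * N. 1 - fps_X ^ i :: rat fps) =
        (\<Prod>i=1..N. 1 - fps_X ^ (d * i)) * (\<Prod>i\<in>I. 1 - fps_X ^ i)"
      using finI by (simp add: prod.union_disjoint prod.reindex)
    also have "(\<Prod>i\<in>I. 1 - fps_X ^ i :: rat fps) = (\<Prod>i\<in>L. 1 - fps_X ^ i) * (\<Prod>i\<in>I - L. 1 - fps_X ^ i)"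
      using prod.subset_diff[OF LI finI] by (simp add: mult.commute)
    finally show ?thesis .
  qed
  have phi1: "fps_agree n (qpoch_inf fps_X fps_X) (\<Prod>i=1..d * N. 1 - fps_X ^ i)"
    using fps_agree_qpoch_inf[of 1 n "d * N"] \<open>N \<le> d * N\<close> by (simp add: N_def)
  have phid: "fps_agree n (qpoch_inf (fps_X ^ d) (fps_X ^ d)) (\<Prod>i=1..N. 1 - fps_X ^ (d * i))"
    using fps_agree_qpoch_inf[of d n N] d by (simp add: N_def)
  have "(Y * B) * (\<Prod>i=1..d * N. 1 - fps_X ^ i) =
      (Y * (\<Prod>i\<in>L. 1 - fps_X ^ i)) * (\<Prod>i=1..N. 1 - fps_X ^ (d * i)) * (B * (\<Prod>i\<in>I - L. 1 - fps_X ^ i))"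
    unfolding split by (simp only: mult_ac)
  then have YB: "(Y * B) * (\<Prod>i=1..d * N. 1 - fps_X ^ i) =
      (Y * (\<Prod>i\<in>L. 1 - fps_X ^ i)) * (\<Prod>i=1..N. 1 - fps_X ^ (d * i))"
    unfolding B_mult by simp
  have "fps_agree n F (Y * B)"
  proof (rule fps_agree_mult_cancel[OF _ phi1])
    show "fps_agree n (F * qpoch_inf fps_X fps_X) (Y * B * (\<Prod>i = 1..d * N. 1 - fps_X ^ i))"
      unfolding F YB by (intro fps_agree_mult fps_agree_sym[OF Y] phid)
    show "fps_nth (qpoch_inf fps_X fps_X) 0 = 1"
      using qpoch_inf_nth_0[of 1] by simp
  qed
  with B0 B_nonneg show ?thesis by (rule that)
qed

text \<open>In the convolution of \<open>Y\<close> and \<open>B\<close> one summand is the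
  coefficient of \<open>Y\<close> times 1; the others are nonnegative.\<close>

lemma regular_quotient_nth_ge:
  fixes F T Y :: "rat fps"
  assumes "d \<ge> 1"
    and "F * qpoch_inf fps_X fps_X = T * qpoch_inf (fps_X ^ d) (fps_X ^ d)"
    and "finite L" "\<And>i. i \<in> L \<Longrightarrow> \<not> d dvd i"
    and "fps_agree n (Y * (\<Prod>i\<in>L. 1 - fps_X ^ i)) T"
    and nonneg: "\<And>m. m \<le> n \<Longrightarrow> fps_nth Y m \<ge> 0"
  shows "fps_nth F n \<ge> fps_nth Y n"
proof -
  obtain B where B: "fps_nth B 0 = 1" "\<And>m. fps_nth B m \<ge> 0" "fps_agree n F (Y * B)"
    using regular_quotient_factor[OF assms(1-5)] by blast
  have "fps_nth Y n = fps_nth Y n * fps_nth B (n - n)" using B(1) by simp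
  also have "\<dots> \<le> (\<Sum>i=0..n. fps_nth Y i * fps_nth B (n - i))"
    using nonneg B(2) by (intro member_le_sum) auto
  also have "\<dots> = fps_nth F n" using B(3) by (simp add: fps_agree_def fps_mult_nth)
  finally show ?thesis .
qed

section \<open>The pentagonal number theorem\<close>

definition pent_sum :: "nat \<Rightarrow> rat fps" where
  "pent_sum k = (\<Sum>j<k. (-1) ^ j * (fps_X ^ pent j - fps_X ^ (pent j + 2 * j + 1)))"

lemma pent_sum_Suc:
  "pent_sum (Suc k) = pent_sum k + (-1) ^ k * (fps_X ^ pent k - fps_X ^ (pent k + 2 * k + 1))"
  by (simp add: pent_sum_def)

lemma pent_sum_conv_int:
  "(\<Sum>n\<in>{- int k<..int k}. fps_const ((-1) powi n) * fps_X ^ nat (n * (3 * n - 1) div 2)) = pent_sum k"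
proof (induction k)
  case 0
  then show ?case by (simp add: pent_sum_def)
next
  case (Suc k)
  let ?f = "\<lambda>n::int. fps_const ((-1) powi n) * fps_X ^ nat (n * (3 * n - 1) div 2) :: rat fps"
  \<comment> \<open>Raising k by one adds the indices -k and k + 1, that is, block
    \<open>k\<close>.\<close>
  have "{- int (Suc k)<..int (Suc k)} = insert (- int k) (insert (int k + 1) {- int k<..int k})"
    by auto
  then have sum: "(\<Sum>n\<in>{- int (Suc k)<..int (Suc k)}. ?f n) = ?f (- int k) + (?f (int k + 1) + pent_sum k)"
    using Suc by simp
  have neg: "?f (- int k) = (-1) ^ k * fps_X ^ pent k"
  proof -
    have "- int k * (3 * - int k - 1) div 2 = int (pent k)"
      using two_int_pent[of k] by (simp add: algebra_simps)
    moreover have "fps_const ((-1) powi (- int k)) = ((-1) ^ k :: rat fps)"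
      by (cases "even k") (simp_all add: power_int_minus flip: fps_const_neg)
    ultimately show ?thesis by (simp only: nat_int)
  qed
  have pos: "?f (int k + 1) = - ((-1) ^ k * fps_X ^ (pent k + 2 * k + 1))"
  proof -
    have "(int k + 1) * (3 * (int k + 1) - 1) div 2 = int (pent k + 2 * k + 1)"
      using two_int_pent[of k] by (simp add: algebra_simps)
    moreover have "fps_const ((-1) powi (int k + 1)) = (- ((-1) ^ k) :: rat fps)"
      by (cases "even k") (simp_all add: power_int_add flip: fps_const_neg)
    ultimately show ?thesis by (simp only: nat_int mult_minus_left)
  qed
  show ?case
    unfolding sum neg pos pent_sum_Suc by (simp add: algebra_simps)
qed

lemma triangle_Suc: "Suc s * (Suc s + 1) div 2 = s * (s + 1) div 2 + Suc s"
  by (simp add: algebra_simps)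

text \<open>
  Shanks' finite form of the pentagonal number theorem: its summand for \<open>s = 0\<close> is the truncated
  Euler product, and all others have order above \<open>n\<close>.
\<close>

lemma shanks_partial_telescope:
  fixes x :: "'a :: comm_ring_1"
  defines "t n s \<equiv> (-1) ^ s * x ^ (s * n + s * (s + 1) div 2) * (\<Prod>i=s+1..n. 1 - x ^ i)"
  assumes "m \<le> n"
  shows "(\<Sum>s\<le>m. t (Suc n) s - t n s) =
    - ((-1) ^ m * x ^ (Suc m * Suc n + m * (m + 1) div 2) * (\<Prod>i=m+1..n. 1 - x ^ i))"
  using assms(2)
proof (induction m)
  case 0
  have "(\<Prod>i=Suc 0..Suc n. 1 - x ^ i) = (\<Prod>i=Suc 0..n. 1 - x ^ i) * (1 - x ^ Suc n)" by simp
  then show ?case by (simp add: t_def algebra_simps)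
next
  case (Suc m)
  define g where "g = m * (m + 1) div 2"
  \<comment> \<open>Every product involved is \<open>Q\<close> times at most one further factor, so
    only exponents remain to be compared.\<close>
  define Q where "Q = (\<Prod>i=Suc m+1..n. 1 - x ^ i)"
  have 1: "(\<Prod>i=m+1..n. 1 - x ^ i) = (1 - x ^ Suc m) * Q"
    using Suc.prems by (simp add: Q_def prod.atLeast_Suc_atMost)
  have 2: "(\<Prod>i=Suc m+1..Suc n. 1 - x ^ i) = Q * (1 - x ^ Suc n)"
    using Suc.prems by (simp add: Q_def)
  have "(\<Sum>s\<le>Suc m. t (Suc n) s - t n s) =
      - ((-1) ^ m * x ^ (Suc m * Suc n + g) * ((1 - x ^ Suc m) * Q))
      + (t (Suc n) (Suc m) - t n (Suc m))"
    by (simp only: sum.atMost_Suc Suc.IH[OF Suc_leD[OF Suc.prems]] 1 g_def)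
  also have "t (Suc n) (Suc m) = - ((-1) ^ m * x ^ (Suc m * Suc n + g + Suc m) * (Q * (1 - x ^ Suc n)))"
    unfolding t_def 2 triangle_Suc g_def by (simp add: add_ac)
  also have "t n (Suc m) = - ((-1) ^ m * x ^ (Suc m * n + g + Suc m) * Q)"
    unfolding t_def triangle_Suc g_def Q_def by (simp add: add_ac)
  also have "Suc m * Suc n + g = Suc m * n + g + Suc m" by simp
  finally show ?case
    unfolding triangle_Suc g_def[symmetric] Q_def[symmetric] by (simp add: algebra_simps power_add)
qed

text \<open>From n to n + 1 the telescope at m = n has an empty product and leaves one monomial.
  With the extra term of the induction hypothesis it completes block \<open>n\<close>; the new
  summand s = n + 1 is the next extra term.\<close>

lemma shanks_identity:
  "(\<Sum>s\<le>n. (-1) ^ s * fps_X ^ (s * n + s * (s + 1) div 2) * (\<Prod>i=s+1..n. 1 - fps_X ^ i)) =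
    pent_sum n + (-1) ^ n * fps_X ^ pent n"
proof (induction n)
  case 0
  then show ?case by (simp add: pent_sum_def pent_def)
next
  case (Suc n)
  define t :: "nat \<Rightarrow> nat \<Rightarrow> rat fps" where
    "t n s = (-1) ^ s * fps_X ^ (s * n + s * (s + 1) div 2) * (\<Prod>i=s+1..n. 1 - fps_X ^ i)" for n s
  have e: "Suc n * Suc n + n * (n + 1) div 2 = pent n + 2 * n + 1"
    "Suc n * Suc n + Suc n * (Suc n + 1) div 2 = pent (Suc n)"
    by (simp_all add: pent_def algebra_simps)
  have "(\<Sum>s\<le>Suc n. t (Suc n) s) = (\<Sum>s\<le>n. t n s) + (\<Sum>s\<le>n. t (Suc n) s - t n s) + t (Suc n) (Suc n)"
    by (simp add: sum_subtractf)
  also have "(\<Sum>s\<le>n. t (Suc n) s - t n s) = - ((-1) ^ n * fps_X ^ (pent n + 2 * n + 1))"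
    unfolding t_def using shanks_partial_telescope[of n n "fps_X :: rat fps"] unfolding e by simp
  also have "t (Suc n) (Suc n) = (-1) ^ Suc n * fps_X ^ pent (Suc n)"
    unfolding t_def e by simp
  finally show ?case using Suc unfolding t_def[symmetric] pent_sum_Suc by (simp add: algebra_simps)
qed

lemma fps_agree_prod_pent_sum:
  assumes "n < N"
  shows "fps_agree n (\<Prod>i=1..N. 1 - fps_X ^ i) (pent_sum N)"
proof -
  define t :: "nat \<Rightarrow> rat fps" where
    "t s = (-1) ^ s * fps_X ^ (s * N + s * (s + 1) div 2) * (\<Prod>i=s+1..N. 1 - fps_X ^ i)" for s
  have high: "fps_nth (f * fps_X ^ e * g :: rat fps) m = 0" if "m < e" for f g e m
  proof -
    have "f * fps_X ^ e * g = fps_X ^ e * (f * g)" by (simp only: mult_ac)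
    then show ?thesis using that by (simp only: fps_X_power_mult_nth if_True)
  qed
  have "fps_nth (\<Prod>i=1..N. 1 - fps_X ^ i :: rat fps) m = fps_nth (pent_sum N) m" if "m \<le> n" for m
  proof -
    have "t 0 + (\<Sum>s\<in>{1..N}. t s) = pent_sum N + (-1) ^ N * fps_X ^ pent N"
      using shanks_identity[of N, folded t_def] by (simp add: atMost_atLeast0 sum.atLeast_Suc_atMost)
    then have "fps_nth (t 0) m + (\<Sum>s\<in>{1..N}. fps_nth (t s) m) =
        fps_nth (pent_sum N) m + fps_nth ((-1) ^ N * fps_X ^ pent N * 1) m"
      by (metis fps_add_nth fps_sum_nth mult.right_neutral)
    moreover have "fps_nth (t s) m = 0" if "s \<in> {1..N}" for s
    proof -
      have "m < s * N + s * (s + 1) div 2"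
        using that assms \<open>m \<le> n\<close> by (cases s) auto
      then show ?thesis unfolding t_def by (rule high)
    qed
    moreover have "fps_nth ((-1) ^ N * fps_X ^ pent N * 1 :: rat fps) m = 0"
      using le_pent[of N] assms \<open>m \<le> n\<close> by (intro high) simp
    ultimately show ?thesis by (simp add: t_def)
  qed
  then show ?thesis by (simp add: fps_agree_def)
qed

section \<open>Coefficient bounds for the infinite products\<close>

lemma minus_one_power_mult_nth: "fps_nth ((-1) ^ j * f) m = (-1) ^ j * fps_nth (f :: rat fps) m"
  by (cases "even j") auto

text \<open>Both exponents of block \<open>k\<close> lie from \<open>pent k\<close> up to below
  \<open>pent (Suc k)\<close>, so terms of different blocks never collide. The two claims need a
  joint induction.\<close>

lemma pent_sum_nth:
  "\<bar>fps_nth (pent_sum k) m\<bar> \<le> 1" "m \<ge> pent k \<Longrightarrow> fps_nth (pent_sum k) m = 0"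
proof (induction k)
  case 0
  case 1
  then show ?case by (simp add: pent_sum_def)
  case 2
  then show ?case by (simp add: pent_sum_def)
next
  case (Suc k)
  case 1
  show ?case using Suc
    by (cases "m < pent k") (auto simp: pent_sum_Suc minus_one_power_mult_nth fps_X_power_nth)
  case 2
  then show ?case using Suc
    by (auto simp: pent_sum_Suc minus_one_power_mult_nth pent_Suc fps_X_power_nth)
qed

text \<open>Coefficient form of substituting X^d for X.\<close>

lemma prod_one_minus_X_power_mult_nth:
  assumes "d \<ge> 1"
  shows "fps_nth (\<Prod>i=1..N. 1 - fps_X ^ (d * i) :: rat fps) n =
    (if d dvd n then fps_nth (\<Prod>i=1..N. 1 - fps_X ^ i) (n div d) else 0)"
proof (induction N arbitrary: n)
  case 0
  then show ?case using assms by (auto elim!: dvdE)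
next
  case (Suc N)
  define P :: "nat \<Rightarrow> nat \<Rightarrow> rat fps" where "P d N = (\<Prod>i=1..N. 1 - fps_X ^ (d * i))" for d N
  have rec: "fps_nth (P e (Suc N)) m =
      fps_nth (P e N) m - (if m < e * Suc N then 0 else fps_nth (P e N) (m - e * Suc N))" for e m
  proof -
    have "P e (Suc N) = P e N - P e N * fps_X ^ (e * Suc N)"
      unfolding P_def by (simp add: algebra_simps del: mult_Suc_right)
    then show ?thesis by (simp only: fps_sub_nth fps_X_power_mult_right_nth)
  qed
  have IH: "fps_nth (P d N) n = (if d dvd n then fps_nth (P 1 N) (n div d) else 0)" for n
    using Suc by (simp add: P_def)
  have "fps_nth (P d (Suc N)) n = (if d dvd n then fps_nth (P 1 (Suc N)) (n div d) else 0)"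
  proof (cases "d dvd n")
    case True
    then obtain m where m: "n = d * m" by (rule dvdE)
    have "d * m - d * Suc N = d * (m - Suc N)" by (rule diff_mult_distrib2[symmetric])
    then show ?thesis
      unfolding rec IH using assms m by (simp del: mult_Suc_right)
  next
    case False
    then have "\<not> d dvd n - d * Suc N" if "\<not> n < d * Suc N"
      using that by (metis dvd_diffD dvd_triv_left not_less)
    then show ?thesis unfolding rec IH using False by simp
  qed
  then show ?case unfolding P_def by simp
qed

lemma qpoch_inf_nth_conv_qpoch_inf_1:
  assumes "d \<ge> 1"
  shows "fps_nth (qpoch_inf (fps_X ^ d) (fps_X ^ d)) n =
    (if d dvd n then fps_nth (qpoch_inf fps_X fps_X) (n div d) else 0)"
  using fps_agree_qpoch_inf[OF assms, of n n] fps_agree_qpoch_inf[of 1 "n div d" n]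
    prod_one_minus_X_power_mult_nth[OF assms, of n n]
  by (simp add: fps_agree_def)

lemma fps_agree_euler_pent_sum:
  assumes "n < N"
  shows "fps_agree n (qpoch_inf fps_X fps_X) (pent_sum N)"
proof -
  have "fps_agree n (qpoch_inf fps_X fps_X) (\<Prod>i=1..N. 1 - fps_X ^ i)"
    using fps_agree_qpoch_inf[of 1 n N] assms by simp
  also have "fps_agree n \<dots> (pent_sum N)"
    using assms by (rule fps_agree_prod_pent_sum)
  finally show ?thesis .
qed

lemma euler_nth:
  "fps_nth (qpoch_inf fps_X fps_X) m \<le> 1"
  "fps_nth (qpoch_inf fps_X fps_X) 1 = -1"
  "fps_nth (qpoch_inf fps_X fps_X) 2 = -1"
  "fps_nth (qpoch_inf fps_X fps_X) 3 = 0"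
  "fps_nth (qpoch_inf fps_X fps_X) 4 = 0"
proof -
  have eq: "fps_nth (qpoch_inf fps_X fps_X) m = fps_nth (pent_sum N) m" if "m < N" for m N
    using fps_agree_euler_pent_sum[OF that] by (simp add: fps_agree_def)
  show "fps_nth (qpoch_inf fps_X fps_X) m \<le> 1"
    using eq[of m "Suc m"] pent_sum_nth(1)[of "Suc m" m] by simp
  show "fps_nth (qpoch_inf fps_X fps_X) 1 = -1"
    "fps_nth (qpoch_inf fps_X fps_X) 2 = -1"
    "fps_nth (qpoch_inf fps_X fps_X) 3 = 0"
    "fps_nth (qpoch_inf fps_X fps_X) 4 = 0"
    by (simp_all add: eq[of _ 5] pent_sum_def lessThan_nat_numeral pent_def fps_X_power_nth
        minus_one_power_mult_nth)
qed

text \<open>Since \<phi>(1) begins 1 - X - X^2 + X^5, the first positive coefficient of \<phi>(d)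
  after the constant term sits at 5d.\<close>

lemma qpoch_inf_nth_le:
  assumes "d \<ge> 1"
  shows "fps_nth (qpoch_inf (fps_X ^ d) (fps_X ^ d)) n \<le> 1"
    and "0 < n \<Longrightarrow> n < 5 * d \<Longrightarrow> fps_nth (qpoch_inf (fps_X ^ d) (fps_X ^ d)) n \<le> 0"
    and "n = d \<or> n = 2 * d \<Longrightarrow> fps_nth (qpoch_inf (fps_X ^ d) (fps_X ^ d)) n = -1"
    and "\<not> d dvd n \<Longrightarrow> fps_nth (qpoch_inf (fps_X ^ d) (fps_X ^ d)) n = 0"
proof -
  note e = qpoch_inf_nth_conv_qpoch_inf_1[OF assms, of n]
  show "fps_nth (qpoch_inf (fps_X ^ d) (fps_X ^ d)) n \<le> 1"
    unfolding e using euler_nth(1) by simp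
  show "fps_nth (qpoch_inf (fps_X ^ d) (fps_X ^ d)) n \<le> 0" if "0 < n" "n < 5 * d"
  proof (cases "d dvd n")
    case True
    then obtain m where m: "n = d * m" by (rule dvdE)
    then have "0 < m" "m < 5" using that by auto
    then have "m = 1 \<or> m = 2 \<or> m = 3 \<or> m = 4" by auto
    then have "fps_nth (qpoch_inf fps_X fps_X) m \<le> 0" using euler_nth(2-5) by auto
    then show ?thesis unfolding e using m assms by simp
  qed (simp add: e)
  show "fps_nth (qpoch_inf (fps_X ^ d) (fps_X ^ d)) n = -1" if "n = d \<or> n = 2 * d"
    using that assms euler_nth(2,3) unfolding e by auto
  show "fps_nth (qpoch_inf (fps_X ^ d) (fps_X ^ d)) n = 0" if "\<not> d dvd n"
    using that unfolding e by simp
qed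

section \<open>Positivity\<close>

text \<open>The sign is normalised so that the leading term X^(pent k) is positive. Cutting at
  \<open>K\<close> keeps the sum finite; \<open>K > n\<close> suffices for coefficients up to
  \<open>n\<close>.\<close>

definition pent_tail :: "nat \<Rightarrow> nat \<Rightarrow> rat fps" where
  "pent_tail k K = (\<Sum>j=k..<K. (-1) ^ (j + k) * (fps_X ^ pent j - fps_X ^ (pent j + 2 * j + 1)))"

lemma fps_agree_pent_tail:
  assumes "k \<ge> 1" "k \<le> K" "n < K"
  shows "fps_agree n ((-1) ^ (k - 1) * (pent_sum k - qpoch_inf fps_X fps_X)) (pent_tail k K)"
proof -
  let ?t = "\<lambda>j. fps_X ^ pent j - fps_X ^ (pent j + 2 * j + 1) :: rat fps"
  have "(\<Sum>j<k. (-1) ^ j * ?t j) + (\<Sum>j=k..<K. (-1) ^ j * ?t j) = (\<Sum>j<K. (-1) ^ j * ?t j)"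
    using sum.atLeastLessThan_concat[of 0 k K "\<lambda>j. (-1) ^ j * ?t j"] assms(2)
    by (simp only: lessThan_atLeast0)
  then have "pent_sum K = pent_sum k + (\<Sum>j=k..<K. (-1) ^ j * ?t j)"
    unfolding pent_sum_def by (rule sym)
  then have "pent_sum k - pent_sum K = - (\<Sum>j=k..<K. (-1) ^ j * ?t j)"
    by (simp only: diff_add_eq_diff_diff_swap) simp
  moreover have "(-1 :: rat fps) ^ (k - 1) = - ((-1) ^ k)" using assms(1) by (cases k) simp_all
  ultimately have "(-1) ^ (k - 1) * (pent_sum k - pent_sum K) = (-1) ^ k * (\<Sum>j=k..<K. (-1) ^ j * ?t j)"
    by (simp only: mult_minus_left mult_minus_right minus_minus)
  also have "\<dots> = pent_tail k K"
    unfolding pent_tail_def sum_distrib_left by (intro sum.cong refl) (simp only: power_add mult_ac)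
  finally show ?thesis
    using fps_agree_mult[OF fps_agree_refl fps_agree_diff[OF fps_agree_refl fps_agree_euler_pent_sum[OF assms(3)]],
        of "(-1) ^ (k - 1)" "pent_sum k"]
    by simp
qed

text \<open>The value 0 below zero models the shift by a power of X; truncated subtraction would
  yield the count at 0, which is 1.\<close>

definition int_part_count :: "nat list \<Rightarrow> int \<Rightarrow> int" where
  "int_part_count as x = (if x < 0 then 0 else int (part_count as (nat x)))"

lemma part_count_mult_pent_tail_nth:
  "fps_nth (Abs_fps (\<lambda>n. of_nat (part_count as n)) * pent_tail k K) m =
    of_int (\<Sum>j=k..<K. (-1) ^ (j + k) * (int_part_count as (int m - int (pent j)) -
      int_part_count as (int m - int (pent j) - 2 * int j - 1)))"
proof -
  let ?P = "Abs_fps (\<lambda>n. of_nat (part_count as n)) :: rat fps"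
  have shift: "fps_nth (?P * fps_X ^ e) m = of_int (int_part_count as (int m - int e))" for e
    by (auto simp: fps_X_power_mult_right_nth int_part_count_def nat_diff_distrib)
  have "?P * ((-1) ^ i * (fps_X ^ e - fps_X ^ e')) = (-1) ^ i * (?P * fps_X ^ e - ?P * fps_X ^ e')"
    for i e e' by (simp only: algebra_simps)
  then have "fps_nth (?P * ((-1) ^ i * (fps_X ^ e - fps_X ^ e'))) m =
      of_int ((-1) ^ i * (int_part_count as (int m - int e) - int_part_count as (int m - int e')))" for i e e'
    by (simp only: minus_one_power_mult_nth fps_sub_nth shift) simp
  then show ?thesis
    unfolding pent_tail_def sum_distrib_left fps_sum_nth of_int_sum
    by (intro sum.cong refl) (simp only: of_nat_add of_nat_mult diff_diff_eq of_nat_numeral of_nat_1 add.assoc)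
qed

lemma part_count_mult_pent_tail_nth_eq_0:
  assumes "m < pent k"
  shows "fps_nth (Abs_fps (\<lambda>n. of_nat (part_count as n)) * pent_tail k K) m = 0"
proof -
  have "int_part_count as (int m - int (pent j)) = 0 \<and>
      int_part_count as (int m - int (pent j) - 2 * int j - 1) = 0" if "j \<ge> k" for j
    using pent_mono[OF that] assms by (simp add: int_part_count_def)
  then show ?thesis unfolding part_count_mult_pent_tail_nth by simp
qed

lemma part_count_mult_pent_tail_nth_pos:
  fixes c s a b :: int
  assumes approx: "\<And>n. c * int (part_count as n) - (2 * int n + s)\<^sup>2 \<in> {- a..b}"
    and pos: "\<And>n. part_count as n > 0" and c: "c > 0"
    and sab: "(s, a, b) \<in> {(9, 49, 39), (8, 36, 16), (6, 16, 12)}"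
    and k: "k \<ge> 2" and m: "pent k \<le> m" "m < K"
  shows "fps_nth (Abs_fps (\<lambda>n. of_nat (part_count as n)) * pent_tail k K) m > 0"
proof -
  let ?D = "\<lambda>j. (-1) ^ (j + k) * (int_part_count as (int m - int (pent j)) -
      int_part_count as (int m - int (pent j) - 2 * int j - 1))"
  \<comment> \<open>\<open>J\<close> is the last block that reaches exponent \<open>m\<close>; all
    later blocks contribute 0.\<close>
  define J where "J = (GREATEST j. pent j \<le> m)"
  have bound: "j \<le> m" if "pent j \<le> m" for j using le_pent[of j] that by simp
  have J: "pent J \<le> m" unfolding J_def using m(1) bound by (rule GreatestI_nat)
  have J_max: "j \<le> J" if "pent j \<le> m" for j
    unfolding J_def using that bound by (rule Greatest_le_nat)
  have kJ: "k \<le> J" using J_max m(1) .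
  have mJ: "m < pent (Suc J)" using J_max[of "Suc J"] by force
  have JK: "J < K" using bound[OF J] m(2) by simp
  have "(\<Sum>j=k..<K. ?D j) = (\<Sum>j=k..J. ?D j)"
  proof (rule sum.mono_neutral_right)
    show "\<forall>j\<in>{k..<K} - {k..J}. ?D j = 0"
    proof
      fix j assume "j \<in> {k..<K} - {k..J}"
      then have "\<not> pent j \<le> m" using J_max by auto
      then show "?D j = 0" by (simp add: int_part_count_def)
    qed
  qed (use JK in auto)
  moreover have "0 < (\<Sum>j=k..J. ?D j)"
  proof (rule alternating_pent_sum_pos[OF c _ _ _ _ sab k kJ J mJ])
    fix x :: int
    show "x < 0 \<Longrightarrow> int_part_count as x = 0" by (simp add: int_part_count_def)
    assume "x \<ge> 0"
    then have x: "int_part_count as x = int (part_count as (nat x))" "int (nat x) = x"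
      by (simp_all add: int_part_count_def)
    show "int_part_count as x > 0" using x pos by simp
    show "(2 * x + s)\<^sup>2 - a \<le> c * int_part_count as x" "c * int_part_count as x \<le> (2 * x + s)\<^sup>2 + b"
      using approx[of "nat x"] x by auto
  qed
  ultimately show ?thesis by (simp only: part_count_mult_pent_tail_nth of_int_0_less_iff)
qed

lemma part_count_prod_set:
  assumes "0 \<notin> set as" "distinct as"
  shows "Abs_fps (\<lambda>n. of_nat (part_count as n)) * (\<Prod>i\<in>set as. 1 - fps_X ^ i) = (1 :: rat fps)"
  unfolding prod.distinct_set_conv_list[OF assms(2)] by (rule part_count_fps[OF assms(1)])

text \<open>\<open>Y\<close> is the tail divided by the factors for \<open>as\<close>: it vanishes
  below \<open>pent k\<close> and is positive from there to \<open>n\<close>. The remaining factor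
  of \<open>F\<close> can only increase the coefficient.\<close>

lemma regular_pent_tail_nth_pos:
  fixes F :: "rat fps" and c s a b :: int
  assumes F: "F * qpoch_inf fps_X fps_X =
      (-1) ^ (k - 1) * (pent_sum k - qpoch_inf fps_X fps_X) * qpoch_inf (fps_X ^ d) (fps_X ^ d)"
    and d: "d \<ge> 1" and as: "\<And>i. i \<in> set as \<Longrightarrow> \<not> d dvd i" "distinct as"
    and approx: "\<And>n. c * int (part_count as n) - (2 * int n + s)\<^sup>2 \<in> {- a..b}"
      "\<And>n. part_count as n > 0" "c > 0" "(s, a, b) \<in> {(9, 49, 39), (8, 36, 16), (6, 16, 12)}"
    and k: "k \<ge> 2" and n: "pent k \<le> n"
  shows "fps_nth F n > 0"
proof -
  define Y where "Y = Abs_fps (\<lambda>n. of_nat (part_count as n)) * pent_tail k (Suc n)"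
  have "0 \<notin> set as" using as(1) by force
  then have "Y * (\<Prod>i\<in>set as. 1 - fps_X ^ i) = pent_tail k (Suc n)"
    unfolding Y_def using part_count_prod_set[of as] as(2) by (simp add: mult.assoc mult.left_commute)
  moreover have "fps_agree n ((-1) ^ (k - 1) * (pent_sum k - qpoch_inf fps_X fps_X)) (pent_tail k (Suc n))"
    using k n le_pent[of k] by (intro fps_agree_pent_tail) auto
  ultimately have Y: "fps_agree n (Y * (\<Prod>i\<in>set as. 1 - fps_X ^ i))
      ((-1) ^ (k - 1) * (pent_sum k - qpoch_inf fps_X fps_X))"
    by (simp add: fps_agree_sym)
  have pos: "fps_nth Y m > 0" if "pent k \<le> m" "m \<le> n" for m
    unfolding Y_def using that by (intro part_count_mult_pent_tail_nth_pos[OF approx k]) auto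
  have "fps_nth Y m \<ge> 0" if "m \<le> n" for m
    using that pos part_count_mult_pent_tail_nth_eq_0[of m k as "Suc n"]
    by (cases "pent k \<le> m") (auto simp: Y_def less_imp_le)
  then have "fps_nth Y n \<le> fps_nth F n"
    using regular_quotient_nth_ge[OF d F _ _ Y] as(1) by simp
  then show ?thesis using pos[OF n] by simp
qed

text \<open>The case k = 1: F + \<phi>(d) generates the partitions whose parts are neither 1 nor
  multiples of \<open>d\<close>. It suffices to exhibit more of them than the coefficient of
  \<phi>(d).\<close>

lemma regular_minus_qpoch_inf_nth_pos:
  fixes F :: "rat fps"
  assumes F: "F * qpoch_inf fps_X fps_X =
      (1 - fps_X - qpoch_inf fps_X fps_X) * qpoch_inf (fps_X ^ d) (fps_X ^ d)"
    and d: "d \<ge> 2" and n: "n \<ge> 2"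
  shows "fps_nth F n > 0"
proof -
  let ?\<phi> = "qpoch_inf (fps_X ^ d) (fps_X ^ d)"
  have F': "(F + ?\<phi>) * qpoch_inf fps_X fps_X = (1 - fps_X) * ?\<phi>"
    using F by (simp add: algebra_simps)
  have ge: "of_nat (part_count as n) \<le> fps_nth F n + fps_nth ?\<phi> n"
    if as: "\<And>i. i \<in> set as \<Longrightarrow> \<not> d dvd i" "distinct as" "1 \<notin> set as" for as
  proof -
    let ?Y = "Abs_fps (\<lambda>n. of_nat (part_count as n)) :: rat fps"
    have "0 \<notin> set as" using as(1) by force
    \<comment> \<open>The factor for the part 1 is the numerator 1 - X itself; hence 1 joins the
      index set without being a part in \<open>as\<close>.\<close>
    then have "?Y * (\<Prod>i\<in>insert 1 (set as). 1 - fps_X ^ i) = 1 - fps_X"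
      using part_count_prod_set[of as] as(2,3) by (simp add: mult.left_commute)
    then have "fps_agree n (?Y * (\<Prod>i\<in>insert 1 (set as). 1 - fps_X ^ i)) (1 - fps_X)"
      by (simp only: fps_agree_refl)
    then have "fps_nth ?Y n \<le> fps_nth (F + ?\<phi>) n"
      using as(1) d by (intro regular_quotient_nth_ge[OF _ F', where L = "insert 1 (set as)"]) auto
    then show ?thesis by simp
  qed
  have d1: "d \<ge> 1" using d by simp
  note e = qpoch_inf_nth_le[OF d1, of n]
  consider "d = 2" | "d = 3" | "d \<ge> 4" using d by linarith
  then show ?thesis
  proof cases
    case 1
    have g: "of_nat (part_count [3, 5, 7] n) \<le> fps_nth F n + fps_nth ?\<phi> n"
      by (rule ge) (use 1 in auto)
    consider "n = 2 \<or> n = 4" | "n \<in> {3, 5, 7, 9, 11}" | "n \<in> {6, 8}" | "n = 10 \<or> n \<ge> 12"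
    proof -
      have "n = 2 \<or> n = 3 \<or> n = 4 \<or> n = 5 \<or> n = 6 \<or> n = 7 \<or> n = 8 \<or> n = 9 \<or> n = 10 \<or> n = 11 \<or> n \<ge> 12"
        using n by presburger
      then show thesis using that by auto
    qed
    then show ?thesis
    proof cases
      case A: 1
      then have "fps_nth ?\<phi> n = -1" using 1 by (intro e(3)) auto
      then show ?thesis using g by simp
    next
      case A: 2
      then have "fps_nth ?\<phi> n = 0" using 1 by (intro e(4)) auto
      moreover have "part_count [3, 5, 7] n \<ge> 1" using A by (intro part_count_357(1)) auto
      ultimately show ?thesis using g by simp
    next
      case A: 3
      then have "fps_nth ?\<phi> n \<le> 0" using 1 by (intro e(2)) auto
      moreover have "part_count [3, 5, 7] n \<ge> 1" using A by (intro part_count_357(1)) auto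
      ultimately show ?thesis using g by simp
    next
      case A: 4
      show ?thesis using part_count_357(2)[OF A] g e(1) by simp
    qed
  next
    case 2
    have g: "of_nat (part_count [2, 5] n) \<le> fps_nth F n + fps_nth ?\<phi> n"
      by (rule ge) (use 2 in auto)
    \<comment> \<open>No sum of 2s and 5s equals 3, but there the coefficient of \<phi>(3) is -1. It
      can be 1 only from 15 = 5d on, where two partitions exist.\<close>
    consider "n = 3" | "n \<noteq> 3" "n < 14" | "n \<ge> 14" by linarith
    then show ?thesis
    proof cases
      case A: 1
      then have "fps_nth ?\<phi> n = -1" using 2 by (intro e(3)) auto
      then show ?thesis using g by simp
    next
      case A: 2
      then have "fps_nth ?\<phi> n \<le> 0" using 2 n by (intro e(2)) auto
      moreover have "part_count [2, 5] n \<ge> 1"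
        using A n part_count_25(1,2)[of n] by (cases "n = 2") auto
      ultimately show ?thesis using g by simp
    next
      case A: 3
      show ?thesis using part_count_25(3)[OF A] g e(1) by simp
    qed
  next
    case 3
    have g: "of_nat (part_count [2, 3] n) \<le> fps_nth F n + fps_nth ?\<phi> n"
      by (rule ge) (use 3 in \<open>auto dest: dvd_imp_le\<close>)
    show ?thesis
    proof (cases "n < 8")
      case True
      then have "fps_nth ?\<phi> n \<le> 0" using 3 n by (intro e(2)) auto
      then show ?thesis using part_count_23(1)[OF n] g by simp
    next
      case False
      then show ?thesis using part_count_23(2)[of n] g e(1) by simp
    qed
  qed
qed

theorem theorem2p7:
  fixes k d :: nat
  assumes "k \<ge> 1" and "d \<ge> 2"
  defines "F \<equiv> (-1) ^ (k - 1) *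
      (inverse (qpoch_inf fps_X fps_X) *
         (\<Sum>n\<in>{- int k<..int k}. fps_const ((-1) powi n) * fps_X ^ nat (n * (3 * n - 1) div 2))
       - 1) * qpoch_inf (fps_X ^ d) (fps_X ^ d)"
  shows "(\<forall>n. n < k * (3 * k + 1) div 2 \<longrightarrow> fps_nth F n = 0) \<and>
         (\<forall>n. n \<ge> k * (3 * k + 1) div 2 \<longrightarrow> fps_nth F n > 0)"
proof -
  let ?\<phi> = "qpoch_inf fps_X fps_X"
  let ?T = "(-1) ^ (k - 1) * (pent_sum k - ?\<phi>)"
  have \<phi>0: "fps_nth ?\<phi> 0 = 1" using qpoch_inf_nth_0[of 1] by simp
  then have "inverse ?\<phi> * ?\<phi> = 1" by (intro inverse_mult_eq_1) simp
  \<comment> \<open>Multiplying by \<phi>(1) removes the inverse and gives the form that the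
    quotient lemmas expect.\<close>
  moreover have "F * ?\<phi> = (-1) ^ (k - 1) *
      (inverse ?\<phi> * ?\<phi> * pent_sum k - ?\<phi>) * qpoch_inf (fps_X ^ d) (fps_X ^ d)"
    unfolding F_def pent_sum_conv_int by (simp add: algebra_simps)
  ultimately have F: "F * ?\<phi> = ?T * qpoch_inf (fps_X ^ d) (fps_X ^ d)" by simp
  have d: "d \<ge> 1" using assms(2) by simp
  have zero: "fps_nth F n = 0" if "n < pent k" for n
  proof -
    \<comment> \<open>Every exponent in the tail is at least \<open>pent k\<close> >
      \<open>n\<close>, so the product of \<open>F\<close> and \<phi>(1) vanishes up to
      \<open>n\<close>, and \<phi>(1) can be cancelled.\<close>
    have "fps_agree n ?T (pent_tail k (k + Suc n))"
      using assms(1) by (intro fps_agree_pent_tail) auto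
    moreover have "fps_nth (pent_tail k (k + Suc n)) m = 0" if "m \<le> n" for m
      unfolding pent_tail_def fps_sum_nth
    proof (intro sum.neutral ballI)
      fix j assume "j \<in> {k..<k + Suc n}"
      then have "m < pent j" using pent_mono[of k j] \<open>m \<le> n\<close> \<open>n < pent k\<close> by auto
      then show "fps_nth ((-1) ^ (j + k) * (fps_X ^ pent j - fps_X ^ (pent j + 2 * j + 1)) :: rat fps) m = 0"
        by (simp add: minus_one_power_mult_nth fps_X_power_nth)
    qed
    ultimately have "fps_agree n ?T 0" by (simp add: fps_agree_def)
    then have "fps_agree n (F * ?\<phi>) (0 * qpoch_inf (fps_X ^ d) (fps_X ^ d))"
      unfolding F by (intro fps_agree_mult fps_agree_refl)
    then have "fps_agree n (F * ?\<phi>) (0 * ?\<phi>)" by simp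
    then have "fps_agree n F 0" by (rule fps_agree_mult_cancel) (simp_all add: fps_agree_refl \<phi>0)
    then show ?thesis by (simp add: fps_agree_def)
  qed
  have pos: "fps_nth F n > 0" if n: "pent k \<le> n" for n
  proof (cases "k = 1")
    case True
    have "F * ?\<phi> = (1 - fps_X - ?\<phi>) * qpoch_inf (fps_X ^ d) (fps_X ^ d)"
      using F True by (simp add: pent_sum_def pent_def)
    moreover have "n \<ge> 2" using n True by (simp add: pent_def)
    ultimately show ?thesis using assms(2) by (intro regular_minus_qpoch_inf_nth_pos[of F d n])
  next
    case False
    then have k: "k \<ge> 2" using assms(1) by simp
    consider "d = 2" | "d = 3" | "d \<ge> 4" using assms(2) by linarith
    then show ?thesis
    proof cases
      case 1
      show ?thesis
        by (rule regular_pent_tail_nth_pos[OF F d _ _ part_count_135_approx part_count_c_b_1_pos _ _ k n])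
          (use 1 in auto)
    next
      case 2
      show ?thesis
        by (rule regular_pent_tail_nth_pos[OF F d _ _ part_count_125_approx part_count_c_b_1_pos _ _ k n])
          (use 2 in auto)
    next
      case 3
      show ?thesis
        by (rule regular_pent_tail_nth_pos[OF F d _ _ part_count_123_approx part_count_c_b_1_pos _ _ k n])
          (use 3 in \<open>auto dest: dvd_imp_le\<close>)
    qed
  qed
  show ?thesis using zero pos unfolding pent_def by blast
qed

end
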